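(* Let $X$ be a real Banach space with topological dual $X^*$, let $K\subseteq X$ be nonempty, weakly compact and convex, and let $A:K\to X^*$ and $a:K\to X$ be two operators. Suppose that $A$ is weak to norm sequentially continuous and of type ql, and that $a$ is weak to weak sequentially continuous. Then the inverted general variational inequality of Stampacchia type $VI_{iS}(A,a,K)$ admits solutions; that is, there exists $x\in K$ such that $$\langle A(y)-A(x),a(x)\rangle\ge 0\quad\text{for all } y\in K.$$
   Context: For $x^*\in X^*$ and $x\in X$, $\langle x^*,x\rangle$ denotes the value of $x^*$ at $x$. For $u,v$ in a real linear space, $[u,v]:=\{(1-t)u+tv: t\in[0,1]\}$ is the closed line segment with endpoints $u,v$. For real linear spaces $X,Y$ and $D\subseteq X$, an operator $A:D\to Y$ is of type ql if for every $x,y\in D$ and every $z\in[x,y]\cap D$ one has $A(z)\in[A(x),A(y)]$. Let $X,Y$ be Banach spaces and $K\subseteq X$. An operator $T:K\to Y$ is weak to norm sequentially continuous if for every $x\in K$ and every sequence $(x_n)\subseteq K$ converging weakly to $x$, $T(x_n)\to T(x)$ in the norm of $Y$. It is weak to weak sequentially continuous if for every $x\in K$ and every sequence $(x_n)\subseteq K$ converging weakly to $x$, $T(x_n)$ converges to $T(x)$ in the weak topology of $Y$. The problem $VI_{iS}(A,a,K)$ consists of finding $x\in K$ such that $\langle A(y)-A(x),a(x)\rangle\ge 0$ for all $y\in K$. *)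

theory Defs
  imports "HOL-Analysis.Analysis"
begin

text \<open>The dual \<open>X\<^sup>*\<close> is the type \<open>'a \<Rightarrow>\<^sub>L real\<close> with the operator norm, and the value
  \<open>\<langle>f, x\<rangle>\<close> is \<open>blinfun_apply f x\<close>. An operator defined on a subset is a total function whose
  values outside that subset are never used.\<close>

text \<open>The coarsest topology on the whole space making every functional in the dual continuous.\<close>

definition weak_topology :: "'a::real_normed_vector topology" where
  "weak_topology =
     topology_generated_by {blinfun_apply f -` U | (f :: 'a \<Rightarrow>\<^sub>L real) U. open U}"

definition type_ql_on :: "'a::real_vector set \<Rightarrow> ('a \<Rightarrow> 'b::real_vector) \<Rightarrow> bool" where
  "type_ql_on D A \<longleftrightarrow>
     (\<forall>x\<in>D. \<forall>y\<in>D. \<forall>z\<in>closed_segment x y \<inter> D. A z \<in> closed_segment (A x) (A y))"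

definition weak_to_norm_seq_continuous_on ::
    "'a::banach set \<Rightarrow> ('a \<Rightarrow> 'b::banach) \<Rightarrow> bool" where
  "weak_to_norm_seq_continuous_on K T \<longleftrightarrow>
     (\<forall>x\<in>K. \<forall>u. range u \<subseteq> K \<longrightarrow> limitin weak_topology u x sequentially \<longrightarrow>
        (\<lambda>n. T (u n)) \<longlonglongrightarrow> T x)"

definition weak_to_weak_seq_continuous_on ::
    "'a::banach set \<Rightarrow> ('a \<Rightarrow> 'b::banach) \<Rightarrow> bool" where
  "weak_to_weak_seq_continuous_on K T \<longleftrightarrow>
     (\<forall>x\<in>K. \<forall>u. range u \<subseteq> K \<longrightarrow> limitin weak_topology u x sequentially \<longrightarrow>
        limitin weak_topology (\<lambda>n. T (u n)) (T x) sequentially)"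

definition VI_iS_solution ::
    "('a::banach \<Rightarrow> 'a \<Rightarrow>\<^sub>L real) \<Rightarrow> ('a \<Rightarrow> 'a) \<Rightarrow> 'a set \<Rightarrow> 'a \<Rightarrow> bool" where
  "VI_iS_solution A a K x \<longleftrightarrow>
     x \<in> K \<and> (\<forall>y\<in>K. blinfun_apply (A y - A x) (a x) \<ge> 0)"

end

theory Submission
  imports Defs
begin

text \<open>For a finite subset \<open>F\<close> of \<open>K\<close>, Brouwer's theorem on the simplex of convex combinations of
  \<open>F\<close> gives \<open>x \<in> K\<close> solving the inequality for all \<open>y \<in> F\<close>: otherwise \<open>x\<close> is a convex combination
  of points \<open>y\<close> with \<open>\<langle>A y, a x\<rangle> < \<langle>A x, a x\<rangle>\<close>, which contradicts that \<open>A x\<close> lies in the convex hull of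
  their images, as type ql forces. By the Eberlein--Smulian theorem \<open>K\<close> is weakly sequentially
  compact, so \<open>A ` K\<close> is norm compact, and finite \<open>F\<^sub>n\<close> exist whose images are \<open>1/n\<close>-nets of \<open>A ` K\<close>.
  A weakly convergent subsequence of the solutions for \<open>F\<^sub>n\<close> converges to a solution for all of \<open>K\<close>,
  because the pairing is continuous along norm convergent functionals and weakly convergent
  (hence bounded) points.\<close>

subsection \<open>The Hahn--Banach theorem\<close>

text \<open>Homogeneity is stated as an inequality because infima deliver it in that form;
  \<open>sublinear_scale\<close> recovers equality by scaling back with
  \<open>inverse c\<close>.\<close>

definition sublinear :: "('a::real_vector \<Rightarrow> real) \<Rightarrow> bool" where
  "sublinear p \<longleftrightarrow>
     (\<forall>x y. p (x + y) \<le> p x + p y) \<and> (\<forall>c\<ge>0. \<forall>x. p (c *\<^sub>R x) \<le> c * p x)"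

lemma sublinear_zero: "sublinear p \<Longrightarrow> p 0 = 0"
proof -
  assume p: "sublinear p"
  have "p (0 *\<^sub>R 0) \<le> 0 * p 0" using p unfolding sublinear_def by blast
  moreover have "p (0 + 0) \<le> p 0 + p 0" using p unfolding sublinear_def by blast
  ultimately show ?thesis by simp
qed

lemma sublinear_neg: "sublinear p \<Longrightarrow> - p (- x) \<le> p x"
proof -
  assume p: "sublinear p"
  then have "p (x + - x) \<le> p x + p (- x)" unfolding sublinear_def by blast
  then show ?thesis using sublinear_zero[OF p] by simp
qed

lemma sublinear_scale: "sublinear p \<Longrightarrow> c \<ge> 0 \<Longrightarrow> p (c *\<^sub>R x) = c * p x"
proof (cases "c = 0")
  case False
  assume p: "sublinear p" and "c \<ge> 0"
  with False have c: "c > 0" by simp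
  have "p (inverse c *\<^sub>R (c *\<^sub>R x)) \<le> inverse c * p (c *\<^sub>R x)"
    using p c unfolding sublinear_def by (meson inverse_nonnegative_iff_nonnegative less_imp_le)
  then have "c * p x \<le> p (c *\<^sub>R x)" using c by (simp add: field_simps)
  moreover have "p (c *\<^sub>R x) \<le> c * p x" using p c unfolding sublinear_def by simp
  ultimately show ?thesis by simp
qed (simp add: sublinear_zero)

text \<open>The members \<open>p i\<close> need not be sublinear themselves: it is enough that sums
  and nonnegative multiples of their values are dominated by some other member. This covers tilts,
  chains in Zorn's lemma and distances to subspaces alike.\<close>

lemma sublinear_Inf:
  fixes p :: "'i \<Rightarrow> 'a::real_vector \<Rightarrow> real"
  assumes ne: "C \<noteq> {}" and bdd: "\<And>x. bdd_below ((\<lambda>i. p i x) ` C)"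
    and add: "\<And>i j x y. i \<in> C \<Longrightarrow> j \<in> C \<Longrightarrow> \<exists>k\<in>C. p k (x + y) \<le> p i x + p j y"
    and scale: "\<And>i c x. i \<in> C \<Longrightarrow> c \<ge> 0 \<Longrightarrow> \<exists>k\<in>C. p k (c *\<^sub>R x) \<le> c * p i x"
  shows "sublinear (\<lambda>x. INF i\<in>C. p i x)"
  unfolding sublinear_def
proof (intro conjI allI impI)
  fix x y
  let ?q = "\<lambda>x. INF i\<in>C. p i x"
  have "?q (x + y) - p i x \<le> p j y" if ij: "i \<in> C" "j \<in> C" for i j
  proof -
    obtain k where "k \<in> C" "p k (x + y) \<le> p i x + p j y" using add[OF ij] by blast
    moreover from \<open>k \<in> C\<close> have "?q (x + y) \<le> p k (x + y)" by (intro cINF_lower bdd)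
    ultimately show ?thesis by simp
  qed
  then have "?q (x + y) - p i x \<le> ?q y" if "i \<in> C" for i
    using that ne by (intro cINF_greatest) auto
  then have "?q (x + y) - ?q y \<le> p i x" if "i \<in> C" for i
    using that by (simp add: algebra_simps)
  then have "?q (x + y) - ?q y \<le> ?q x"
    using ne by (intro cINF_greatest) auto
  then show "?q (x + y) \<le> ?q x + ?q y" by simp
next
  fix c :: real and x :: 'a assume c: "c \<ge> 0"
  let ?q = "\<lambda>x. INF i\<in>C. p i x"
  have low: "?q (c *\<^sub>R x) \<le> c * p i x" if "i \<in> C" for i
  proof -
    obtain k where "k \<in> C" "p k (c *\<^sub>R x) \<le> c * p i x" using scale[OF \<open>i \<in> C\<close> c, of x] by blast
    moreover from \<open>k \<in> C\<close> have "?q (c *\<^sub>R x) \<le> p k (c *\<^sub>R x)" by (intro cINF_lower bdd)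
    ultimately show ?thesis by simp
  qed
  show "?q (c *\<^sub>R x) \<le> c * ?q x"
  proof (cases "c = 0")
    case True
    then show ?thesis using low ne by auto
  next
    case False
    with c have "c > 0" by simp
    then have "?q (c *\<^sub>R x) / c \<le> p i x" if "i \<in> C" for i
      using low[OF that] by (simp add: field_simps)
    then have "?q (c *\<^sub>R x) / c \<le> ?q x" using ne by (intro cINF_greatest) auto
    then show ?thesis using \<open>c > 0\<close> by (simp add: field_simps)
  qed
qed

text \<open>The witness is the infimum over t \<ge> 0 of
  \<open>p (x + t *\<^sub>R z) - t * p z\<close>: t = 0 gives \<open>q x \<le> p x\<close>, and t =
  1 at \<open>- z\<close> gives the last bound. It serves both to make minimal functionals odd and
  to force a separating functional to be positive at \<open>z\<close>.\<close>

lemma sublinear_tilt: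
  assumes p: "sublinear p"
  obtains q where "sublinear q" "\<And>x. q x \<le> p x" "q (- z) \<le> - p z"
proof
  define q where "q = (\<lambda>x. INF t\<in>{0..}. p (x + t *\<^sub>R z) - t * p z)"
  have add: "p (x + y) \<le> p x + p y" for x y using p unfolding sublinear_def by blast
  have bdd: "bdd_below ((\<lambda>t. p (x + t *\<^sub>R z) - t * p z) ` {0..})" for x
  proof (rule bdd_belowI2)
    fix t :: real assume "t \<in> {0..}"
    then have "t * p z = p ((x + t *\<^sub>R z) + (- x))" using sublinear_scale[OF p] by simp
    also have "\<dots> \<le> p (x + t *\<^sub>R z) + p (- x)" by (rule add)
    finally show "- p (- x) \<le> p (x + t *\<^sub>R z) - t * p z" by simp
  qed
  show "sublinear q"
    unfolding q_def
  proof (rule sublinear_Inf[OF _ bdd])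
    fix s t :: real and x y assume "s \<in> {0..}" "t \<in> {0..}"
    have "p (x + y + (s + t) *\<^sub>R z) = p ((x + s *\<^sub>R z) + (y + t *\<^sub>R z))"
      by (simp add: algebra_simps)
    also have "\<dots> \<le> p (x + s *\<^sub>R z) + p (y + t *\<^sub>R z)" by (rule add)
    finally show "\<exists>k\<in>{0..}. p (x + y + k *\<^sub>R z) - k * p z
        \<le> p (x + s *\<^sub>R z) - s * p z + (p (y + t *\<^sub>R z) - t * p z)"
      using \<open>s \<in> {0..}\<close> \<open>t \<in> {0..}\<close> by (intro bexI[of _ "s + t"]) (auto simp: algebra_simps)
  next
    fix t c :: real and x assume "t \<in> {0..}" "c \<ge> 0"
    have "p (c *\<^sub>R x + (c * t) *\<^sub>R z) = c * p (x + t *\<^sub>R z)"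
      using sublinear_scale[OF p \<open>c \<ge> 0\<close>, of "x + t *\<^sub>R z"] by (simp add: scaleR_right_distrib)
    then show "\<exists>k\<in>{0..}. p (c *\<^sub>R x + k *\<^sub>R z) - k * p z \<le> c * (p (x + t *\<^sub>R z) - t * p z)"
      using \<open>t \<in> {0..}\<close> \<open>c \<ge> 0\<close> by (intro bexI[of _ "c * t"]) (auto simp: algebra_simps)
  qed auto
  show "q x \<le> p x" for x
    unfolding q_def using cINF_lower[OF bdd, of 0 x] by simp
  show "q (- z) \<le> - p z"
    unfolding q_def using cINF_lower[OF bdd, of 1 "- z"] sublinear_zero[OF p] by simp
qed

text \<open>By the previous lemma a pointwise minimal sublinear functional is odd, hence linear.\<close>

lemma Hahn_Banach_sublinear:
  fixes p :: "'a::real_vector \<Rightarrow> real"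
  assumes p: "sublinear p"
  obtains f where "linear f" "\<And>x. f x \<le> p x"
proof -
  let ?A = "{q. sublinear q \<and> q \<le> p}"
  \<comment> \<open>The order is reversed, so that the maximal element supplied by Zorn's lemma is
    pointwise minimal.\<close>
  let ?P = "\<lambda>q r :: 'a \<Rightarrow> real. r \<le> q"
  have "\<exists>m\<in>?A. \<forall>a\<in>?A. ?P m a \<longrightarrow> a = m"
  proof (rule predicate_Zorn)
    show "partial_order_on ?A (relation_of ?P ?A)"
      by (rule partial_order_on_relation_ofI) auto
  next
    fix C assume C: "C \<in> Chains (relation_of ?P ?A)"
    then have CA: "C \<subseteq> ?A" unfolding Chains_def relation_of_def by auto
    have ch: "q \<le> r \<or> r \<le> q" if "q \<in> C" "r \<in> C" for q r
      using C that unfolding Chains_def relation_of_def by auto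
    show "\<exists>u\<in>?A. \<forall>a\<in>C. ?P a u"
    proof (cases "C = {}")
      case True
      then show ?thesis using p by auto
    next
      case False
      \<comment> \<open>The pointwise infimum bounds the chain; it is finite because every sublinear
        \<open>q \<le> p\<close> satisfies
        \<open>q x \<ge> - q (- x) \<ge> - p (- x)\<close>.\<close>
      define u where "u = (\<lambda>x. INF q\<in>C. q x)"
      have bdd: "bdd_below ((\<lambda>q. q x) ` C)" for x
      proof (rule bdd_belowI2)
        fix q assume "q \<in> C"
        then have "sublinear q" "q (- x) \<le> p (- x)" using CA by (auto simp: le_fun_def)
        then show "- p (- x) \<le> q x" using sublinear_neg[of q x] by linarith
      qed
      have low: "u \<le> q" if "q \<in> C" for q
        unfolding u_def le_fun_def using cINF_lower[OF bdd that] by simp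
      have "sublinear u"
        unfolding u_def
      proof (rule sublinear_Inf[OF False bdd])
        fix q r :: "'a \<Rightarrow> real" and x y assume qr: "q \<in> C" "r \<in> C"
        have "\<exists>k\<in>C. k \<le> q \<and> k \<le> r" using ch[OF qr] qr by auto
        then obtain k where k: "k \<in> C" "k \<le> q" "k \<le> r" by blast
        then have "k (x + y) \<le> k x + k y" using CA unfolding sublinear_def by blast
        also have "\<dots> \<le> q x + r y" using k by (intro add_mono) (auto simp: le_fun_def)
        finally show "\<exists>k\<in>C. k (x + y) \<le> q x + r y" using k by blast
      next
        fix q :: "'a \<Rightarrow> real" and c :: real and x assume "q \<in> C" "c \<ge> 0"
        then show "\<exists>k\<in>C. k (c *\<^sub>R x) \<le> c * q x"
          using CA unfolding sublinear_def by blast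
      qed
      moreover have "u \<le> p" using low False CA by (blast intro: order_trans)
      ultimately show ?thesis using low by blast
    qed
  qed
  then obtain m where m: "sublinear m" "m \<le> p"
    and min: "\<And>q. sublinear q \<Longrightarrow> q \<le> p \<Longrightarrow> q \<le> m \<Longrightarrow> q = m" by blast
  have neg: "m (- z) = - m z" for z
  proof -
    \<comment> \<open>By minimality, tilting \<open>m\<close> at \<open>z\<close> changes nothing,
      so the tilt's bound at \<open>- z\<close> holds for \<open>m\<close> itself.\<close>
    obtain q where q: "sublinear q" "\<And>x. q x \<le> m x" "q (- z) \<le> - m z"
      using sublinear_tilt[OF m(1)] by blast
    then have "q = m" using min m(2) by (meson le_funI order_trans)
    then show ?thesis using q(3) sublinear_neg[OF m(1), of z] by simp
  qed
  have "linear m"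
  proof (rule linearI)
    fix x y
    have le: "m (x + y) \<le> m x + m y" for x y using m(1) unfolding sublinear_def by blast
    have "m ((- x) + (- y)) \<le> m (- x) + m (- y)" by (rule le)
    then have "m x + m y \<le> m (x + y)" using neg[of "x + y"] by (simp add: neg)
    then show "m (x + y) = m x + m y" using le[of x y] by simp
  next
    fix c :: real and x
    show "m (c *\<^sub>R x) = c *\<^sub>R m x"
    proof (cases "c \<ge> 0")
      case False
      then have "m (- ((- c) *\<^sub>R x)) = - ((- c) * m x)"
        using sublinear_scale[OF m(1), of "- c" x] neg by simp
      then show ?thesis by simp
    qed (simp add: sublinear_scale[OF m(1)])
  qed
  then show ?thesis using that m(2) by (auto simp: le_fun_def)
qed

section \<open>Separating a point from a closed subspace\<close>

lemma sublinear_infdist: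
  fixes W :: "'a::real_normed_vector set"
  assumes W: "subspace W"
  shows "sublinear (\<lambda>x. infdist x W)"
proof -
  have ne: "W \<noteq> {}" using subspace_0[OF W] by blast
  have eq: "infdist x W = (INF w\<in>W. norm (x - w))" for x :: 'a
    using ne by (simp add: infdist_notempty dist_norm)
  show ?thesis unfolding eq
  proof (rule sublinear_Inf[OF ne])
    show "bdd_below ((\<lambda>w. norm (x - w)) ` W)" for x :: 'a
      by (rule bdd_belowI2[where m = 0]) simp
  next
    fix v w x y assume "v \<in> W" "w \<in> W"
    then show "\<exists>k\<in>W. norm (x + y - k) \<le> norm (x - v) + norm (y - w)"
      using norm_triangle_ineq[of "x - v" "y - w"] subspace_add[OF W]
      by (intro bexI[of _ "v + w"]) (auto simp: algebra_simps)
  next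
    fix w x and c :: real assume "w \<in> W" "c \<ge> 0"
    have "c *\<^sub>R x - c *\<^sub>R w = c *\<^sub>R (x - w)" by (simp add: algebra_simps)
    then have "norm (c *\<^sub>R x - c *\<^sub>R w) = c * norm (x - w)" using \<open>c \<ge> 0\<close> by simp
    then show "\<exists>k\<in>W. norm (c *\<^sub>R x - k) \<le> c * norm (x - w)"
      using \<open>w \<in> W\<close> subspace_scale[OF W] by (intro bexI[of _ "c *\<^sub>R w"]) auto
  qed
qed

text \<open>Tilting the distance to \<open>W\<close> at \<open>z\<close> before applying Hahn-Banach
  takes the place of extending a functional from a subspace. A linear functional below the tilt is
  dominated by the distance, so it is bounded and vanishes on \<open>W\<close>, while its value at
  \<open>z\<close> is at least the distance of \<open>z\<close>, which is positive as
  \<open>W\<close> is closed.\<close>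

lemma separate_closed_subspace:
  fixes W :: "'a::real_normed_vector set"
  assumes W: "subspace W" "closed W" and z: "z \<notin> W"
  obtains \<phi> :: "'a \<Rightarrow>\<^sub>L real" where "\<And>w. w \<in> W \<Longrightarrow> \<phi> w = 0" "\<phi> z \<noteq> 0"
proof -
  have W0: "0 \<in> W" by (rule subspace_0[OF W(1)])
  obtain q where q: "sublinear q" "\<And>x. q x \<le> infdist x W" "q (- z) \<le> - infdist z W"
    using sublinear_tilt[OF sublinear_infdist[OF W(1)]] by blast
  obtain f where f: "linear f" "\<And>x. f x \<le> q x" using Hahn_Banach_sublinear[OF q(1)] by blast
  have fd: "f x \<le> infdist x W" for x using f(2) q(2) order_trans by blast
  have fn: "f x \<le> norm x" for x
    using fd[of x] infdist_le[OF W0, of x] by (simp add: dist_norm)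
  have "bounded_linear f"
  proof (rule bounded_linear_intro[where K = 1])
    show "norm (f x) \<le> norm x * 1" for x
      using fn[of x] fn[of "- x"] linear_neg[OF f(1), of x] by (simp add: abs_le_iff)
  qed (auto simp: linear_add[OF f(1)] linear_scale[OF f(1)])
  then have \<phi>: "blinfun_apply (Blinfun f) = f" by (rule bounded_linear_Blinfun_apply)
  have "f w = 0" if "w \<in> W" for w
    using fd[of w] fd[of "- w"] that subspace_neg[OF W(1) that] linear_neg[OF f(1), of w] by simp
  moreover have "f z > 0"
  proof -
    have "infdist z W > 0" using infdist_pos_not_in_closed[OF W(2) _ z] W0 by blast
    moreover have "f (- z) \<le> - infdist z W" using f(2) q(3) order_trans by blast
    ultimately show ?thesis using linear_neg[OF f(1), of z] by simp
  qed
  ultimately show ?thesis using that[of "Blinfun f"] by (simp add: \<phi>)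
qed

subsection \<open>Weak convergence\<close>

lemma openin_weak_topology_vimage:
  fixes \<phi> :: "'a::real_normed_vector \<Rightarrow>\<^sub>L real"
  shows "open U \<Longrightarrow> openin weak_topology (blinfun_apply \<phi> -` U)"
  unfolding weak_topology_def by (rule topology_generated_by_Basis) blast

lemma topspace_weak_topology [simp]: "topspace weak_topology = UNIV"
  using openin_subset[OF openin_weak_topology_vimage[OF open_UNIV]] by auto

lemma continuous_map_weak_topology:
  fixes \<phi> :: "'a::real_normed_vector \<Rightarrow>\<^sub>L real"
  shows "continuous_map weak_topology euclidean (blinfun_apply \<phi>)"
  using openin_weak_topology_vimage[of _ \<phi>] by (simp add: continuous_map_def vimage_def)

text \<open>For the converse, the property that the sequence eventually enters a set containing
  \<open>x\<close> passes to finite intersections and arbitrary unions, so it need only be checked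
  on the generating sets.\<close>

lemma limitin_weak_topology:
  fixes u :: "nat \<Rightarrow> 'a::real_normed_vector"
  shows "limitin weak_topology u x sequentially \<longleftrightarrow>
    (\<forall>\<phi> :: 'a \<Rightarrow>\<^sub>L real. (\<lambda>n. \<phi> (u n)) \<longlonglongrightarrow> \<phi> x)"
proof
  assume L: "limitin weak_topology u x sequentially"
  show "\<forall>\<phi> :: 'a \<Rightarrow>\<^sub>L real. (\<lambda>n. \<phi> (u n)) \<longlonglongrightarrow> \<phi> x"
    using continuous_map_limit[OF continuous_map_weak_topology L] by (simp add: comp_def)
next
  assume R: "\<forall>\<phi> :: 'a \<Rightarrow>\<^sub>L real. (\<lambda>n. \<phi> (u n)) \<longlonglongrightarrow> \<phi> x"
  have "eventually (\<lambda>n. u n \<in> S) sequentially" if S: "openin weak_topology S" "x \<in> S" for S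
    using openin_topology_generated_by[OF S(1)[unfolded weak_topology_def]] S(2)
  proof induction
    case (Int a b)
    then show ?case by (auto intro: eventually_conj)
  next
    case (UN K)
    then obtain k where k: "k \<in> K" "x \<in> k" by blast
    from UN.IH[OF k] show ?case by eventually_elim (use k in blast)
  next
    case (Basis s)
    then obtain \<phi> :: "'a \<Rightarrow>\<^sub>L real" and U where U: "s = blinfun_apply \<phi> -` U" "open U" by blast
    then have "eventually (\<lambda>n. \<phi> (u n) \<in> U) sequentially"
      using topological_tendstoD R Basis.prems by blast
    then show ?case using U by simp
  qed simp
  then show "limitin weak_topology u x sequentially" by (simp add: limitin_def)
qed

lemma tendsto_imp_limitin_weak_topology:
  fixes u :: "nat \<Rightarrow> 'a::real_normed_vector"
  shows "u \<longlonglongrightarrow> x \<Longrightarrow> limitin weak_topology u x sequentially"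
  by (auto simp: limitin_weak_topology intro!: tendsto_intros)

text \<open>Baire's theorem applied to the sets of functionals bounded by \<open>m\<close> along the sequence.\<close>

lemma weakly_convergent_uniformly_bounded:
  fixes v :: "nat \<Rightarrow> 'a::real_normed_vector"
  assumes v: "limitin weak_topology v x sequentially"
  obtains M where "\<And>n (\<phi> :: 'a \<Rightarrow>\<^sub>L real). \<bar>blinfun_apply \<phi> (v n)\<bar> \<le> M * norm \<phi>"
proof -
  define F where "F m = {\<phi> :: 'a \<Rightarrow>\<^sub>L real. \<forall>n. \<bar>blinfun_apply \<phi> (v n)\<bar> \<le> real m}" for m
  have closed: "closed (F m)" for m
    unfolding F_def by (intro closed_Collect_all closed_Collect_le continuous_intros)
  have "\<phi> \<in> (\<Union>m. F m)" for \<phi> :: "'a \<Rightarrow>\<^sub>L real"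
  proof -
    have "(\<lambda>n. \<phi> (v n)) \<longlonglongrightarrow> \<phi> x" using v limitin_weak_topology by blast
    then have "Bseq (\<lambda>n. \<phi> (v n))" by (intro convergent_imp_Bseq convergentI)
    then obtain C where "\<And>n. \<bar>blinfun_apply \<phi> (v n)\<bar> \<le> C" by (auto simp: Bseq_def)
    then have "\<phi> \<in> F (nat \<lceil>C\<rceil>)" unfolding F_def by (smt (verit) mem_Collect_eq real_nat_ceiling_ge)
    then show ?thesis by blast
  qed
  then have cover: "(\<Union>m. F m) = UNIV" by blast
  \<comment> \<open>The dual is complete, so countably many closed sets with empty interior cannot
    cover it.\<close>
  have "\<exists>m. interior (F m) \<noteq> {}"
  proof (rule ccontr)
    assume "\<not> ?thesis"
    then have "euclidean interior_of \<Union>(range F) = {}"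
      using closed
      by (intro Baire_category_alt disjI1 completely_metrizable_space_euclidean) auto
    then show False using cover by simp
  qed
  then obtain m \<phi>0 e where e: "e > 0" "cball \<phi>0 e \<subseteq> F m"
    by (metis equals0I mem_interior_cball)
  have bound: "\<bar>blinfun_apply \<phi> (v n)\<bar> \<le> (2 * real m / e) * norm \<phi>" for n and \<phi> :: "'a \<Rightarrow>\<^sub>L real"
  proof (cases "\<phi> = 0")
    case False
    \<comment> \<open>This scaling keeps \<open>\<phi>0 + c *\<^sub>R \<phi>\<close> in the ball;
      the two bounds by \<open>m\<close> then give 2m for the difference.\<close>
    define c where "c = e / norm \<phi>"
    have c: "c > 0" using False e by (simp add: c_def)
    have "\<phi>0 \<in> F m" "\<phi>0 + c *\<^sub>R \<phi> \<in> F m"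
      using e c False by (auto simp: dist_norm c_def intro!: subsetD[OF e(2)])
    then have "\<bar>\<phi>0 (v n)\<bar> \<le> m" "\<bar>\<phi>0 (v n) + c * \<phi> (v n)\<bar> \<le> m"
      by (auto simp: F_def plus_blinfun.rep_eq scaleR_blinfun.rep_eq)
    then have "\<bar>c * \<phi> (v n)\<bar> \<le> 2 * real m" by linarith
    then have "c * \<bar>blinfun_apply \<phi> (v n)\<bar> \<le> 2 * real m" using c by (simp add: abs_mult)
    then show ?thesis using c False e by (simp add: c_def field_simps)
  qed simp
  show ?thesis by (rule that[OF bound])
qed

text \<open>Write \<open>\<Phi> n (v n)\<close> as
  \<open>(\<Phi> n - \<psi>) (v n) + \<psi> (v n)\<close>: the first term is at most
  \<open>M * norm (\<Phi> n - \<psi>)\<close> by uniform boundedness, the second converges by weak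
  convergence.\<close>

lemma tendsto_blinfun_apply_weak:
  fixes \<Phi> :: "nat \<Rightarrow> 'a::real_normed_vector \<Rightarrow>\<^sub>L real"
  assumes \<Phi>: "\<Phi> \<longlonglongrightarrow> \<psi>" and v: "limitin weak_topology v x sequentially"
  shows "(\<lambda>n. \<Phi> n (v n)) \<longlonglongrightarrow> \<psi> x"
proof -
  obtain M where M: "\<And>n (\<phi> :: 'a \<Rightarrow>\<^sub>L real). \<bar>blinfun_apply \<phi> (v n)\<bar> \<le> M * norm \<phi>"
    using weakly_convergent_uniformly_bounded[OF v] by blast
  have "(\<lambda>n. (\<Phi> n - \<psi>) (v n)) \<longlonglongrightarrow> 0"
  proof (rule Lim_null_comparison)
    show "eventually (\<lambda>n. norm ((\<Phi> n - \<psi>) (v n)) \<le> M * norm (\<Phi> n - \<psi>)) sequentially"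
      using M by (simp only: real_norm_def eventually_True)
    show "(\<lambda>n. M * norm (\<Phi> n - \<psi>)) \<longlonglongrightarrow> 0"
      using \<Phi> by (auto intro!: tendsto_mult_right_zero tendsto_norm_zero simp: LIM_zero_iff)
  qed
  moreover have "(\<lambda>n. \<psi> (v n)) \<longlonglongrightarrow> \<psi> x" using v limitin_weak_topology by blast
  ultimately have "(\<lambda>n. (\<Phi> n - \<psi>) (v n) + \<psi> (v n)) \<longlonglongrightarrow> 0 + \<psi> x" by (rule tendsto_add)
  then show ?thesis by (simp add: minus_blinfun.rep_eq)
qed

section \<open>Product topologies and countable dense subsets\<close>

lemma tendsto_fun_iff:
  fixes f :: "'c \<Rightarrow> 'i \<Rightarrow> 'b::topological_space"
  shows "(f \<longlongrightarrow> l) F \<longleftrightarrow> (\<forall>i. ((\<lambda>c. f c i) \<longlongrightarrow> l i) F)"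
  using limitin_componentwise[of "\<lambda>i::'i. euclidean :: 'b topology" UNIV f l F]
  by (simp add: euclidean_product_topology)

lemma compact_Pi_UNIV:
  fixes S :: "'i \<Rightarrow> 'b::topological_space set"
  assumes "\<And>i. compact (S i)"
  shows "compact (Pi UNIV S)"
proof -
  have "compactin (product_topology (\<lambda>i::'i. euclidean :: 'b topology) UNIV) (PiE UNIV S)"
    using assms by (simp add: compactin_PiE)
  then show ?thesis by (simp add: euclidean_product_topology PiE_UNIV_domain Pi_def)
qed

text \<open>Choose one point of \<open>S\<close> in each basic open set that meets \<open>S\<close>.
  The dense set must lie inside \<open>S\<close>, since its points will be lifted to functionals in
  the unit ball.\<close>

lemma countable_dense_subset:
  fixes S :: "'a::second_countable_topology set"
  obtains T where "countable T" "T \<subseteq> S" "S \<subseteq> closure T"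
proof -
  obtain B :: "'a set set" where B: "countable B" "topological_basis B"
    using ex_countable_basis by blast
  define T where "T = (\<lambda>b. SOME x. x \<in> b \<inter> S) ` {b \<in> B. b \<inter> S \<noteq> {}}"
  have c: "(SOME x. x \<in> b \<inter> S) \<in> b \<inter> S" if "b \<inter> S \<noteq> {}" for b
    using that some_in_eq by blast
  show ?thesis
  proof
    show "countable T" unfolding T_def using B(1) by simp
    show "T \<subseteq> S" unfolding T_def using c by blast
    show "S \<subseteq> closure T"
    proof
      fix x assume "x \<in> S"
      show "x \<in> closure T"
        unfolding closure_iff_nhds_not_empty
      proof clarify
        fix U V assume "V \<subseteq> U" "x \<in> V" "open V" and T: "T \<inter> U = {}"
        then obtain b where b: "b \<in> B" "x \<in> b" "b \<subseteq> V"
          using topological_basisE[OF B(2)] by metis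
        then have "b \<inter> S \<noteq> {}" using \<open>x \<in> S\<close> by blast
        then have "(SOME x. x \<in> b \<inter> S) \<in> T \<inter> U"
          using b c[of b] \<open>V \<subseteq> U\<close> unfolding T_def by blast
        then show False using T by blast
      qed
    qed
  qed
qed

subsection \<open>Weak sequential compactness\<close>

text \<open>Otherwise every point of \<open>K\<close> has a neighbourhood that the sequence
  eventually avoids, and a finite subcover leaves no place for \<open>u n\<close>.\<close>

lemma compactin_cluster_point:
  fixes u :: "nat \<Rightarrow> 'a"
  assumes K: "compactin X K" and u: "range u \<subseteq> K"
  obtains x where "x \<in> K"
    "\<And>S. openin X S \<Longrightarrow> x \<in> S \<Longrightarrow> frequently (\<lambda>n. u n \<in> S) sequentially"
proof -
  have "\<exists>x\<in>K. \<forall>S. openin X S \<and> x \<in> S \<longrightarrow> frequently (\<lambda>n. u n \<in> S) sequentially"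
  proof (rule ccontr)
    assume "\<not> ?thesis"
    then have "\<forall>x\<in>K. \<exists>S. openin X S \<and> x \<in> S \<and> eventually (\<lambda>n. u n \<notin> S) sequentially"
      by (simp add: not_frequently)
    then obtain S where S: "\<And>x. x \<in> K \<Longrightarrow> openin X (S x)" "\<And>x. x \<in> K \<Longrightarrow> x \<in> S x"
      "\<And>x. x \<in> K \<Longrightarrow> eventually (\<lambda>n. u n \<notin> S x) sequentially"
      by metis
    obtain \<F> where \<F>: "finite \<F>" "\<F> \<subseteq> S ` K" "K \<subseteq> \<Union>\<F>"
      using compactinD[OF K, of "S ` K"] S(1,2) by blast
    have "eventually (\<lambda>n. \<forall>T\<in>\<F>. u n \<notin> T) sequentially"
      using \<F>(1,2) S(3) by (intro eventually_ball_finite) auto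
    then have "eventually (\<lambda>n :: nat. False) sequentially"
      by (rule eventually_mono) (use u \<F>(3) in blast)
    then show False by simp
  qed
  then show ?thesis using that by blast
qed

text \<open>Tychonoff's theorem for a countable product of intervals replaces the diagonal
  argument.\<close>

lemma bounded_seqs_convergent_subseq:
  fixes b :: "nat \<Rightarrow> nat \<Rightarrow> real"
  assumes "\<And>i k. \<bar>b k i\<bar> \<le> M i"
  obtains r l where "strict_mono (r :: nat \<Rightarrow> nat)" "\<And>i. (\<lambda>k. b (r k) i) \<longlonglongrightarrow> l i"
proof -
  have "seq_compact (Pi UNIV (\<lambda>i. {- M i..M i}))"
    by (intro compact_imp_seq_compact compact_Pi_UNIV) simp
  moreover have "\<forall>k. b k \<in> Pi UNIV (\<lambda>i. {- M i..M i})"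
    using assms by (simp add: Pi_iff abs_le_iff) (metis minus_le_iff)
  ultimately obtain l r where "strict_mono (r :: nat \<Rightarrow> nat)" "(b \<circ> r) \<longlonglongrightarrow> l"
    by (rule seq_compactE)
  then show ?thesis using that[of r l] by (simp add: tendsto_fun_iff)
qed

text \<open>This rests on the idea that the dual ball of a separable space is weak-star separable.
  Recording each functional by its values along \<open>u\<close> maps the unit ball into the second
  countable space of real sequences; the functionals \<open>\<Psi> j\<close> are preimages of a
  countable dense subset of the image.\<close>

lemma countable_total_functionals:
  fixes u :: "nat \<Rightarrow> 'a::real_normed_vector"
  obtains \<Psi> :: "nat \<Rightarrow> 'a \<Rightarrow>\<^sub>L real"
  where "\<And>w (\<phi> :: 'a \<Rightarrow>\<^sub>L real). w \<in> closure (span (range u)) \<Longrightarrow>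
    (\<And>j. blinfun_apply (\<Psi> j) w = 0) \<Longrightarrow> blinfun_apply \<phi> w = 0"
proof -
  define ev :: "('a \<Rightarrow>\<^sub>L real) \<Rightarrow> nat \<Rightarrow> real" where "ev \<phi> = (\<lambda>n. \<phi> (u n))" for \<phi>
  obtain T where T: "countable T" "T \<subseteq> ev ` cball 0 1" "ev ` cball 0 1 \<subseteq> closure T"
    by (rule countable_dense_subset)
  have "T \<noteq> {}" using T(3) by auto
  have "\<exists>\<phi>. norm \<phi> \<le> 1 \<and> ev \<phi> = from_nat_into T j" for j
  proof -
    have "from_nat_into T j \<in> ev ` cball 0 1" using from_nat_into[OF \<open>T \<noteq> {}\<close>] T(2) by blast
    then show ?thesis by (metis imageE mem_cball_0)
  qed
  then obtain \<Psi> where \<Psi>: "\<And>j. norm (\<Psi> j) \<le> 1" "\<And>j. ev (\<Psi> j) = from_nat_into T j"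
    by metis
  have unit: "\<phi> w = 0"
    if w: "w \<in> closure (span (range u))" and \<Psi>w: "\<And>j. \<Psi> j w = 0" and \<phi>: "norm \<phi> \<le> 1"
    for w and \<phi> :: "'a \<Rightarrow>\<^sub>L real"
  proof -
    have "ev \<phi> \<in> closure T" using T(3) \<phi> by auto
    then obtain t where t: "\<And>k. t k \<in> T" "t \<longlonglongrightarrow> ev \<phi>"
      using closure_sequential by metis
    define s where "s k = \<Psi> (to_nat_on T (t k))" for k
    have "ev (s k) = t k" for k using t(1) T(1) \<Psi>(2) by (simp add: s_def)
    then have lim: "(\<lambda>k. s k (u n)) \<longlonglongrightarrow> \<phi> (u n)" for n
      using t(2) by (simp add: tendsto_fun_iff ev_def fun_eq_iff)
    \<comment> \<open>Pointwise convergence is known along \<open>u\<close> and extends linearly to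
      the span; reaching the closure takes the approximation below.\<close>
    have "subspace {v. (\<lambda>k. s k v) \<longlonglongrightarrow> \<phi> v}"
      by (auto simp: subspace_def blinfun.add_right blinfun.scaleR_right blinfun.zero_right
          intro!: tendsto_intros)
    then have span: "span (range u) \<subseteq> {v. (\<lambda>k. s k v) \<longlonglongrightarrow> \<phi> v}"
      using lim by (intro span_minimal) auto
    have "\<bar>\<phi> w\<bar> \<le> e" if "e > 0" for e
    proof -
      \<comment> \<open>Each \<open>s k\<close> vanishes at \<open>w\<close> and has norm at most 1,
        so \<open>s k v\<close> is at most e/2 in absolute value; the limit bounds
        \<open>\<phi> v\<close>, and one more e/2 bounds \<open>\<phi> w\<close>.\<close>
      obtain v where v: "v \<in> span (range u)" "dist v w < e / 2"
        using w \<open>e > 0\<close> closure_approachable[of w "span (range u)"] half_gt_zero by blast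
      have small: "\<bar>\<psi> (v - w)\<bar> \<le> e / 2" if "norm \<psi> \<le> 1" for \<psi> :: "'a \<Rightarrow>\<^sub>L real"
      proof -
        have "\<bar>\<psi> (v - w)\<bar> \<le> norm \<psi> * norm (v - w)" using norm_blinfun[of \<psi> "v - w"] by simp
        also have "\<dots> \<le> 1 * (e / 2)" using that v(2) by (intro mult_mono) (auto simp: dist_norm)
        finally show ?thesis by simp
      qed
      have "\<bar>s k v\<bar> \<le> e / 2" for k
        using small[of "s k"] \<Psi>w \<Psi>(1) by (simp add: s_def blinfun.diff_right)
      moreover have "(\<lambda>k. \<bar>s k v\<bar>) \<longlonglongrightarrow> \<bar>\<phi> v\<bar>" using span v(1) by (intro tendsto_rabs) blast
      ultimately have "\<bar>\<phi> v\<bar> \<le> e / 2" by (intro LIMSEQ_le_const2) auto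
      then show ?thesis using small[OF \<phi>] by (simp add: blinfun.diff_right abs_if split: if_splits)
    qed
    then show ?thesis by (metis abs_le_zero_iff dense_ge)
  qed
  show ?thesis
  proof (rule that)
    fix w and \<phi> :: "'a \<Rightarrow>\<^sub>L real"
    assume w: "w \<in> closure (span (range u))" "\<And>j. \<Psi> j w = 0"
    define c where "c = inverse (1 + norm \<phi>)"
    have pos: "1 + norm \<phi> > 0" using norm_ge_zero[of \<phi>] by linarith
    then have "norm (c *\<^sub>R \<phi>) \<le> 1" by (simp add: c_def field_simps)
    from unit[OF w this] pos show "\<phi> w = 0" by (simp add: c_def scaleR_blinfun.rep_eq)
  qed
qed

lemma subspace_closure:
  fixes S :: "'a::real_normed_vector set"
  assumes "subspace S"
  shows "subspace (closure S)"
  unfolding subspace_def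
proof (intro conjI ballI allI)
  show "0 \<in> closure S" using subspace_0[OF assms] closure_subset by blast
next
  fix x y assume "x \<in> closure S" "y \<in> closure S"
  then obtain a b where "\<And>n. a n \<in> S" "a \<longlonglongrightarrow> x" "\<And>n. b n \<in> S" "b \<longlonglongrightarrow> y"
    by (metis closure_sequential)
  then show "x + y \<in> closure S"
    unfolding closure_sequential
    by (intro exI[of _ "\<lambda>n. a n + b n"]) (auto intro!: subspace_add[OF assms] tendsto_add)
next
  fix c :: real and x assume "x \<in> closure S"
  then obtain a where "\<And>n. a n \<in> S" "a \<longlonglongrightarrow> x" by (metis closure_sequential)
  then show "c *\<^sub>R x \<in> closure S"
    unfolding closure_sequential
    by (intro exI[of _ "\<lambda>n. c *\<^sub>R a n"]) (auto intro!: subspace_scale[OF assms] tendsto_intros)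
qed

text \<open>This is the easy half of the Eberlein--Smulian theorem. Countably many functionals separate the points of the closed span of the
  sequence, which contains all weak cluster points; a subsequence along which these functionals
  converge therefore has only one cluster point.\<close>

theorem weakly_compact_imp_seq_compact:
  fixes u :: "nat \<Rightarrow> 'a::real_normed_vector"
  assumes K: "compactin weak_topology K" and u: "range u \<subseteq> K"
  obtains x r where "x \<in> K" "strict_mono (r :: nat \<Rightarrow> nat)"
    "limitin weak_topology (u \<circ> r) x sequentially"
proof -
  let ?W = "closure (span (range u))"
  have W: "subspace ?W" "closed ?W" "range u \<subseteq> ?W"
    using closure_subset[of "span (range u)"] span_superset[of "range u"]
    by (auto intro: subspace_closure)
  obtain \<Psi> :: "nat \<Rightarrow> 'a \<Rightarrow>\<^sub>L real" where \<Psi>: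
    "\<And>w (\<phi> :: 'a \<Rightarrow>\<^sub>L real). w \<in> ?W \<Longrightarrow> (\<And>j. blinfun_apply (\<Psi> j) w = 0) \<Longrightarrow> blinfun_apply \<phi> w = 0"
    using countable_total_functionals by blast
  have "\<exists>M. \<forall>x\<in>K. \<bar>\<Psi> j x\<bar> \<le> M" for j
  proof -
    have "compact (\<Psi> j ` K)"
      using image_compactin[OF K continuous_map_weak_topology] by simp
    then show ?thesis by (auto simp: bounded_iff dest!: compact_imp_bounded)
  qed
  then obtain M where M: "\<And>j x. x \<in> K \<Longrightarrow> \<bar>\<Psi> j x\<bar> \<le> M j" by metis
  obtain r l where r: "strict_mono (r :: nat \<Rightarrow> nat)" and l: "\<And>j. (\<lambda>k. \<Psi> j (u (r k))) \<longlonglongrightarrow> l j"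
    using bounded_seqs_convergent_subseq[of "\<lambda>k j. \<Psi> j (u k)" M] M u by blast
  define v where "v = u \<circ> r"
  \<comment> \<open>Stated for all subsequences: the identity yields the limit, and a subsequence
    avoiding a neighbourhood will yield the contradiction.\<close>
  have cluster: "\<exists>x\<in>K \<inter> ?W. (\<forall>j. \<Psi> j x = l j) \<and>
      (\<forall>(\<phi> :: 'a \<Rightarrow>\<^sub>L real) U. open U \<and> \<phi> x \<in> U \<longrightarrow> frequently (\<lambda>k. \<phi> (v (s k)) \<in> U) sequentially)"
    if s: "strict_mono s" for s :: "nat \<Rightarrow> nat"
  proof -
    have "range (v \<circ> s) \<subseteq> K" using u by (auto simp: v_def)
    then obtain x where x: "x \<in> K"
      "\<And>S. openin weak_topology S \<Longrightarrow> x \<in> S \<Longrightarrow> frequently (\<lambda>n. (v \<circ> s) n \<in> S) sequentially"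
      using compactin_cluster_point[OF K] by metis
    have fr: "frequently (\<lambda>k. \<phi> (v (s k)) \<in> U) sequentially"
      if "open U" "\<phi> x \<in> U" for \<phi> :: "'a \<Rightarrow>\<^sub>L real" and U
      using x(2)[OF openin_weak_topology_vimage[OF that(1)], of \<phi>] that(2) by simp
    \<comment> \<open>The closed span is weakly closed: a functional vanishing on it but not at
      \<open>x\<close> would keep the sequence out of a weak neighbourhood of
      \<open>x\<close>.\<close>
    have "x \<in> ?W"
    proof (rule ccontr)
      assume "x \<notin> ?W"
      then obtain \<phi> :: "'a \<Rightarrow>\<^sub>L real" where \<phi>: "\<And>w. w \<in> ?W \<Longrightarrow> \<phi> w = 0" "\<phi> x \<noteq> 0"
        using separate_closed_subspace[OF W(1,2)] by blast
      then have "\<phi> (v (s k)) = 0" for k using W(3) by (auto simp: v_def)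
      then show False using fr[of "- {0}" \<phi>] \<phi>(2) by (simp add: open_Compl)
    qed
    moreover have "\<Psi> j x = l j" for j
    proof (rule ccontr)
      assume ne: "\<Psi> j x \<noteq> l j"
      obtain U V where UV: "open U" "open V" "\<Psi> j x \<in> U" "l j \<in> V" "U \<inter> V = {}"
        using hausdorff[OF ne] by blast
      have "(\<lambda>k. \<Psi> j (v (s k))) \<longlonglongrightarrow> l j"
        using LIMSEQ_subseq_LIMSEQ[OF l s] by (simp add: v_def comp_def)
      then have "eventually (\<lambda>k. \<Psi> j (v (s k)) \<in> V) sequentially"
        using UV by (intro topological_tendstoD)
      then have "eventually (\<lambda>k. \<Psi> j (v (s k)) \<notin> U) sequentially"
        by (rule eventually_mono) (use UV(5) in blast)
      then show False using fr[OF UV(1,3)] by (simp add: frequently_def)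
    qed
    ultimately show ?thesis using x(1) fr by blast
  qed
  obtain x where x: "x \<in> K" "x \<in> ?W" "\<And>j. \<Psi> j x = l j"
    using cluster[of id] strict_mono_id by blast
  have "(\<lambda>k. \<phi> (v k)) \<longlonglongrightarrow> \<phi> x" for \<phi> :: "'a \<Rightarrow>\<^sub>L real"
  proof (rule ccontr)
    assume "\<not> ?thesis"
    then obtain U where U: "open U" "\<phi> x \<in> U" "frequently (\<lambda>k. \<phi> (v k) \<notin> U) sequentially"
      by (auto simp: tendsto_def not_eventually)
    then have "infinite {k. \<phi> (v k) \<notin> U}" by (simp add: cofinite_eq_sequentially[symmetric] frequently_cofinite)
    \<comment> \<open>A cluster point \<open>y\<close> of this subsequence agrees with
      \<open>x\<close> under every \<open>\<Psi> j\<close>, hence under \<open>\<phi>\<close>,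
      although the subsequence avoids \<open>U\<close>.\<close>
    then obtain s :: "nat \<Rightarrow> nat" where s: "strict_mono s" "\<And>k. \<phi> (v (s k)) \<notin> U"
      using infinite_enumerate by blast
    obtain y where y: "y \<in> ?W" "\<And>j. \<Psi> j y = l j"
      "\<And>U. open U \<Longrightarrow> \<phi> y \<in> U \<Longrightarrow> frequently (\<lambda>k. \<phi> (v (s k)) \<in> U) sequentially"
      using cluster[OF s(1)] by blast
    have "\<phi> (x - y) = 0"
    proof (rule \<Psi>)
      show "x - y \<in> ?W" by (rule subspace_diff[OF W(1) x(2) y(1)])
      show "\<Psi> j (x - y) = 0" for j by (simp add: blinfun.diff_right x(3) y(2))
    qed
    then have "\<phi> y \<in> U" using U(2) by (simp add: blinfun.diff_right)
    then show False using y(3)[OF U(1)] s(2) by simp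
  qed
  then show ?thesis using that[OF x(1) r] by (simp add: limitin_weak_topology v_def)
qed

subsection \<open>Brouwer's theorem on cubes and simplices\<close>

text \<open>The dimension is a number rather than a type because the size of the nets is unbounded; this
  is why the proof goes back to Kuhn's combinatorial lemma.\<close>

lemma brouwer_cube_nat:
  fixes f :: "(nat \<Rightarrow> real) \<Rightarrow> nat \<Rightarrow> real"
  assumes cont: "continuous_on (Pi UNIV (\<lambda>_. {0..1})) f"
    and maps: "\<And>x i. x \<in> Pi UNIV (\<lambda>_. {0..1}) \<Longrightarrow> f x i \<in> {0..1}"
  obtains x where "x \<in> Pi UNIV (\<lambda>_. {0..1})" "\<And>i. i < n \<Longrightarrow> f x i = x i"
proof -
  let ?C = "Pi UNIV (\<lambda>_ :: nat. {0..1 :: real})"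
  \<comment> \<open>Grid points of mesh 1/(p+1), padded with 0 in the coordinates from
    \<open>n\<close> on.\<close>
  define g where "g p x = (\<lambda>j. if j < n then real (x j) / real (Suc p) else 0)" for p and x :: "nat \<Rightarrow> nat"
  \<comment> \<open>Label 0 means that \<open>f\<close> does not decrease coordinate i. The
    exception at \<open>Suc p\<close> enforces label 1 on the upper face, as Kuhn's lemma demands;
    there \<open>f\<close> cannot exceed the coordinate anyway.\<close>
  define label :: "nat \<Rightarrow> (nat \<Rightarrow> nat) \<Rightarrow> nat \<Rightarrow> nat" where
    "label p x i = (if g p x i \<le> f (g p x) i \<and> x i \<noteq> Suc p then 0 else 1)" for p x i
  have gC: "g p x \<in> ?C" if "\<forall>j<n. x j \<le> Suc p" for p x
    using that by (auto simp: g_def divide_le_eq_1)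
  have le0: "g p x i \<le> f (g p x) i" if "\<forall>j<n. x j \<le> Suc p" "label p x i = 0" for p x i
    using that by (auto simp: label_def split: if_splits)
  have le1: "f (g p x) i \<le> g p x i" if "\<forall>j<n. x j \<le> Suc p" "label p x i = 1" "i < n" for p x i
    using that maps[OF gC[OF that(1)], of i] by (auto simp: label_def g_def split: if_splits)
  have label01: "label p x i = 0 \<or> label p x i = 1" for p x i by (simp add: label_def)
  define cell :: "(nat \<Rightarrow> nat) \<Rightarrow> (nat \<Rightarrow> nat) \<Rightarrow> bool" where
    "cell q r \<longleftrightarrow> (\<forall>j<n. q j \<le> r j \<and> r j \<le> q j + 1)" for q r
  have "\<exists>q. (\<forall>i<n. q i < Suc p) \<and>
      (\<forall>i<n. \<exists>r s. cell q r \<and> cell q s \<and> label p r i \<noteq> label p s i)" for p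
  proof (rule kuhn_lemma[of "Suc p" n "label p"])
    show "\<forall>x. (\<forall>i<n. x i \<le> Suc p) \<longrightarrow> (\<forall>i<n. label p x i = 0 \<or> label p x i = 1)"
      using label01 by blast
    show "\<forall>x. (\<forall>i<n. x i \<le> Suc p) \<longrightarrow> (\<forall>i<n. x i = Suc p \<longrightarrow> label p x i = 1)"
      by (simp add: label_def)
    show "\<forall>x. (\<forall>i<n. x i \<le> Suc p) \<longrightarrow> (\<forall>i<n. x i = 0 \<longrightarrow> label p x i = 0)"
    proof (intro allI impI)
      fix x i assume x: "\<forall>j<n. x j \<le> Suc p" and i: "i < n" "x i = 0"
      have "f (g p x) i \<in> {0..1}" by (rule maps[OF gC[OF x]])
      then show "label p x i = 0" using i by (simp add: label_def g_def)
    qed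
  next
    fix q assume "\<forall>i<n. q i < Suc p" and "\<forall>i<n. \<exists>r s. (\<forall>j<n. q j \<le> r j \<and> r j \<le> q j + 1) \<and>
      (\<forall>j<n. q j \<le> s j \<and> s j \<le> q j + 1) \<and> label p r i \<noteq> label p s i"
    then show ?thesis unfolding cell_def by (intro exI[of _ q] conjI)
  qed simp
  then obtain q where q: "\<And>p i. i < n \<Longrightarrow> q p i < Suc p"
    "\<And>p i. i < n \<Longrightarrow> \<exists>r s. cell (q p) r \<and> cell (q p) s \<and> label p r i \<noteq> label p s i"
    by metis
  have near: "\<exists>r s. cell (q p) r \<and> cell (q p) s \<and> label p r i = 0 \<and> label p s i = 1"
    if i: "i < n" for p i
  proof -
    obtain r s where rs: "cell (q p) r" "cell (q p) s" "label p r i \<noteq> label p s i"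
      using q(2)[OF i] by blast
    then show ?thesis using label01[of p r i] label01[of p s i] by auto
  qed
  have near_in: "\<forall>j<n. r j \<le> Suc p" if "cell (q p) r" for r p
  proof (intro allI impI)
    fix j assume "j < n"
    then show "r j \<le> Suc p" using that q(1)[of j p] by (auto simp: cell_def dest!: spec[of _ j])
  qed
  have dist: "\<bar>g p r j - g p (q p) j\<bar> \<le> 1 / real (Suc p)"
    if "cell (q p) r" for p r j
  proof (cases "j < n")
    case True
    then have "q p j \<le> r j" "r j \<le> q p j + 1" using that by (auto simp: cell_def)
    then have "\<bar>real (r j) - real (q p j)\<bar> \<le> 1" by linarith
    then show ?thesis using True by (simp add: g_def diff_divide_distrib[symmetric] divide_right_mono)
  qed (simp add: g_def)
  have "\<bar>g p (q p) i\<bar> \<le> 1" for p i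
  proof -
    have "g p (q p) \<in> ?C" using q(1) by (intro gC) (simp add: less_imp_le)
    then have "g p (q p) i \<in> {0..1}" by blast
    then show ?thesis by simp
  qed
  then obtain t z where t: "strict_mono (t :: nat \<Rightarrow> nat)"
    and z: "\<And>i. (\<lambda>k. g (t k) (q (t k)) i) \<longlonglongrightarrow> z i"
    using bounded_seqs_convergent_subseq[of "\<lambda>p. g p (q p)" "\<lambda>_. 1"] by blast
  have "z i \<in> {0..1}" for i
  proof (rule closed_sequentially[OF _ _ z])
    show "g (t k) (q (t k)) i \<in> {0..1}" for k
    proof -
      have "g (t k) (q (t k)) \<in> ?C" using q(1) by (intro gC) (simp add: less_imp_le)
      then show "g (t k) (q (t k)) i \<in> {0..1}" by blast
    qed
  qed simp
  then have zC: "z \<in> ?C" by auto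
  \<comment> \<open>Since the mesh shrinks to 0, any choice of vertices from the cells has the same
    limit as their corners.\<close>
  have lim: "(\<lambda>k. g (t k) (r k) i) \<longlonglongrightarrow> z i \<and> (\<lambda>k. f (g (t k) (r k)) i) \<longlonglongrightarrow> f z i"
    if r: "\<And>k. cell (q (t k)) (r k)" for r i
  proof -
    have d: "(\<lambda>k. g (t k) (r k) j - g (t k) (q (t k)) j) \<longlonglongrightarrow> 0" for j
    proof (rule Lim_null_comparison)
      show "eventually (\<lambda>k. norm (g (t k) (r k) j - g (t k) (q (t k)) j) \<le> inverse (real (Suc (t k)))) sequentially"
        using dist[OF r] by (simp add: inverse_eq_divide)
      show "(\<lambda>k. inverse (real (Suc (t k)))) \<longlonglongrightarrow> 0"
        using LIMSEQ_subseq_LIMSEQ[OF LIMSEQ_inverse_real_of_nat t] by (simp add: comp_def)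
    qed
    have gz: "(\<lambda>k. g (t k) (r k) j) \<longlonglongrightarrow> z j" for j
      using tendsto_add[OF d[of j] z[of j]] by simp
    have "(\<lambda>k. f (g (t k) (r k))) \<longlonglongrightarrow> f z"
    proof (rule continuous_on_tendsto_compose[OF cont _ zC])
      show "(\<lambda>k. g (t k) (r k)) \<longlonglongrightarrow> z" using gz by (simp add: tendsto_fun_iff)
      show "eventually (\<lambda>k. g (t k) (r k) \<in> ?C) sequentially"
        by (intro always_eventually allI gC near_in r)
    qed
    then show ?thesis using gz by (simp add: tendsto_fun_iff)
  qed
  have "f z i = z i" if i: "i < n" for i
  proof -
    \<comment> \<open>Every cell has vertices of both labels for coordinate i; the two resulting
      sequences give the two inequalities in the limit.\<close>
    obtain r s where
      r: "\<And>k. cell (q (t k)) (r k)" "\<And>k. label (t k) (r k) i = 0" and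
      s: "\<And>k. cell (q (t k)) (s k)" "\<And>k. label (t k) (s k) i = 1"
      using near[OF i, of "t k" for k] by metis
    have "z i \<le> f z i"
      using lim[OF r(1), of i] le0[OF near_in[OF r(1)] r(2)] by (blast intro: LIMSEQ_le)
    moreover have "f z i \<le> z i"
      using lim[OF s(1), of i] le1[OF near_in[OF s(1)] s(2) i] by (blast intro: LIMSEQ_le)
    ultimately show ?thesis by simp
  qed
  then show ?thesis using that[OF zC] by blast
qed

text \<open>\<open>f\<close> below is Nash's map, precomposed with a retraction \<open>\<rho>\<close> of the cube to the simplex.\<close>

lemma simplex_complementarity:
  fixes h :: "nat \<Rightarrow> (nat \<Rightarrow> real) \<Rightarrow> real" and n :: nat
  defines "D \<equiv> {x. (\<forall>i<n. 0 \<le> x i) \<and> sum x {..<n} = 1}"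
  assumes n: "n > 0" and h: "\<And>i. i < n \<Longrightarrow> continuous_on D (h i)"
  obtains x where "x \<in> D" "(\<forall>i<n. h i x \<le> 0) \<or> (\<forall>i<n. 0 < x i \<longrightarrow> 0 < h i x)"
proof -
  let ?C = "Pi UNIV (\<lambda>_ :: nat. {0..1 :: real})"
  define s :: "(nat \<Rightarrow> real) \<Rightarrow> real" where "s x = sum x {..<n}" for x
  \<comment> \<open>A deficit of the coordinate sum is spread evenly over the \<open>n\<close>
    coordinates; a sum above 1 is normalised by division.\<close>
  define \<rho> where "\<rho> x = (\<lambda>i. (x i + max 0 (1 - s x) / n) / max 1 (s x))" for x
  define G where "G x = (\<Sum>i<n. max 0 (h i (\<rho> x)))" for x
  define f where "f x = (\<lambda>i. if i < n then (\<rho> x i + max 0 (h i (\<rho> x))) / (1 + G x) else 0)" for x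
  have \<rho>D: "\<rho> x \<in> D" if "x \<in> ?C" for x
  proof -
    have "sum (\<rho> x) {..<n} = (s x + max 0 (1 - s x)) / max 1 (s x)"
      using n unfolding \<rho>_def by (simp add: sum_divide_distrib[symmetric] sum.distrib s_def)
    also have "\<dots> = 1" by (simp add: max_def)
    moreover have "0 \<le> \<rho> x i" for i using that by (auto simp: \<rho>_def Pi_iff)
    ultimately show ?thesis by (simp add: D_def)
  qed
  have G0: "G x \<ge> 0" for x by (simp add: G_def sum_nonneg)
  have cx: "continuous_on ?C (\<lambda>x. x i)" for i
    by (rule continuous_on_subset[OF continuous_on_product_coordinates]) simp
  have cs: "continuous_on ?C s"
    unfolding s_def[abs_def] by (intro continuous_on_sum cx)
  have c\<rho>: "continuous_on ?C \<rho>"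
    unfolding \<rho>_def[abs_def]
    by (intro continuous_on_coordinatewise_then_product continuous_intros cx cs) (use n in auto)
  have ch: "continuous_on ?C (\<lambda>x. h i (\<rho> x))" if "i < n" for i
    using \<rho>D by (intro continuous_on_compose2[OF h[OF that] c\<rho>]) blast
  have cf: "continuous_on ?C f"
  proof (rule continuous_on_coordinatewise_then_product)
    fix i
    show "continuous_on ?C (\<lambda>x. f x i)"
    proof (cases "i < n")
      case True
      have "continuous_on ?C (\<lambda>x. \<rho> x i)"
        by (rule continuous_on_product_then_coordinatewise[OF c\<rho>])
      moreover have "continuous_on ?C G"
        unfolding G_def[abs_def] by (intro continuous_intros ch) auto
      moreover have "1 + G x \<noteq> 0" for x using G0[of x] by linarith
      ultimately show ?thesis
        using True ch[OF True] by (simp add: f_def) (intro continuous_intros; simp)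
    qed (simp add: f_def)
  qed
  have maps: "f x i \<in> {0..1}" if x: "x \<in> ?C" for x i
  proof (cases "i < n")
    case True
    have "max 0 (h i (\<rho> x)) \<le> G x"
      unfolding G_def using True by (intro member_le_sum) auto
    moreover have "\<rho> x i \<le> sum (\<rho> x) {..<n}"
      using True \<rho>D[OF x] by (intro member_le_sum) (auto simp: D_def)
    ultimately show ?thesis
      using True \<rho>D[OF x] G0[of x] by (auto simp: f_def D_def divide_le_eq_1)
  qed (simp add: f_def)
  obtain x where x: "x \<in> ?C" "\<And>i. i < n \<Longrightarrow> f x i = x i"
    using brouwer_cube_nat[OF cf maps] by blast
  \<comment> \<open>The values of \<open>f\<close> sum to 1, so the fixed point already lies on the
    simplex and \<open>\<rho>\<close> leaves it unchanged.\<close>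
  have "s x = (\<Sum>i<n. f x i)" unfolding s_def using x(2) by (intro sum.cong) auto
  also have "\<dots> = (sum (\<rho> x) {..<n} + G x) / (1 + G x)"
    by (simp add: f_def G_def sum_divide_distrib[symmetric] sum.distrib)
  also have "\<dots> = 1" using \<rho>D[OF x(1)] G0[of x] by (simp add: D_def)
  finally have "\<rho> x = x" by (simp add: \<rho>_def)
  then have xD: "x \<in> D" using \<rho>D[OF x(1)] by simp
  \<comment> \<open>The fixed point equation cleared of its denominator; whether \<open>G x\<close>
    vanishes decides between the two alternatives.\<close>
  have eq: "x i * G x = max 0 (h i x)" if "i < n" for i
    using x(2)[OF that] G0[of x] \<open>\<rho> x = x\<close> that by (simp add: f_def field_simps split: if_splits)
  show ?thesis
  proof (rule that[OF xD])
    show "(\<forall>i<n. h i x \<le> 0) \<or> (\<forall>i<n. 0 < x i \<longrightarrow> 0 < h i x)"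
    proof (cases "G x = 0")
      case True
      then have "h i x \<le> 0" if "i < n" for i using eq[OF that] by (simp add: max_def split: if_splits)
      then show ?thesis by blast
    next
      case False
      then have "0 < h i x" if "i < n" "0 < x i" for i
      proof -
        have "0 < x i * G x" using False G0[of x] that(2) by simp
        then show ?thesis using eq[OF that(1)] by (simp add: max_def split: if_splits)
      qed
      then show ?thesis by blast
    qed
  qed
qed

subsection \<open>The variational inequality\<close>

text \<open>Induction on \<open>S\<close>: a point of the hull of \<open>insert y S\<close> lies on
  a segment from \<open>y\<close> to some \<open>z\<close> in the hull of \<open>S\<close>, and
  convexity keeps all three points in \<open>K\<close>, where type ql applies.\<close>

lemma type_ql_on_convex_hull:
  assumes "type_ql_on K A" "convex K" "finite S" "S \<subseteq> K" "x \<in> convex hull S"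
  shows "A x \<in> convex hull (A ` S)"
  using assms(3-5)
proof (induction S arbitrary: x rule: finite_induct)
  case (insert y S)
  show ?case
  proof (cases "S = {}")
    case True
    then show ?thesis using insert.prems by simp
  next
    case False
    then obtain u v z where uv: "u \<ge> 0" "v \<ge> 0" "u + v = 1" "z \<in> convex hull S"
      "x = u *\<^sub>R y + v *\<^sub>R z"
      using insert.prems(2) unfolding convex_hull_insert[OF False] by blast
    have K: "convex hull (insert y S) \<subseteq> K" using insert.prems(1) assms(2) by (rule hull_minimal)
    have "z \<in> K" using K uv(4) hull_mono[of S "insert y S" convex] by blast
    moreover have "u = 1 - v" "v \<le> 1" using uv by auto
    then have "x \<in> closed_segment y z"
      unfolding closed_segment_def using uv(2,5) by blast
    ultimately have "A x \<in> closed_segment (A y) (A z)"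
      using assms(1) K insert.prems unfolding type_ql_on_def by blast
    moreover have "A z \<in> convex hull (A ` insert y S)"
      using insert.IH[OF _ uv(4)] insert.prems(1) hull_mono[of "A ` S" "A ` insert y S" convex] by blast
    moreover have "A y \<in> convex hull (A ` insert y S)" by (simp add: hull_inc)
    ultimately show ?thesis
      using closed_segment_subset[OF _ _ convex_convex_hull] by blast
  qed
qed simp

lemma VI_finite:
  fixes A :: "'a::banach \<Rightarrow> 'a \<Rightarrow>\<^sub>L real"
  assumes K: "convex K" and A: "weak_to_norm_seq_continuous_on K A" and ql: "type_ql_on K A"
    and a: "weak_to_weak_seq_continuous_on K a" and F: "finite F" "F \<noteq> {}" "F \<subseteq> K"
  obtains x where "x \<in> K" "\<And>y. y \<in> F \<Longrightarrow> 0 \<le> blinfun_apply (A y - A x) (a x)"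
proof -
  obtain n :: nat and y where y: "F = y ` {..<n}"
    using F(1) by (auto simp: finite_conv_nat_seg_image lessThan_def)
  have n: "n > 0" using F(2) y by (auto intro!: Nat.gr0I)
  define D where "D = {x. (\<forall>i<n. 0 \<le> x i) \<and> sum x {..<n} = (1 :: real)}"
  define \<xi> where "\<xi> l = (\<Sum>i<n. l i *\<^sub>R y i)" for l
  \<comment> \<open>\<open>h i l\<close> is the amount by which \<open>y i\<close> violates the
    inequality at \<open>\<xi> l\<close>; the first complementarity alternative is therefore the
    claim.\<close>
  define h where "h i l = (A (\<xi> l) - A (y i)) (a (\<xi> l))" for i l
  have yK: "y i \<in> K" if "i < n" for i using that F(3) y by auto
  have \<xi>K: "\<xi> l \<in> K" if "l \<in> D" for l
    unfolding \<xi>_def using that yK by (intro convex_sum K) (auto simp: D_def)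
  have "continuous_on D (h i)" if "i < n" for i
    unfolding continuous_on_sequentially
  proof (intro allI ballI impI, elim conjE)
    fix u l assume l: "l \<in> D" and u: "\<forall>k. u k \<in> D" "u \<longlonglongrightarrow> l"
    have "(\<lambda>k. \<xi> (u k)) \<longlonglongrightarrow> \<xi> l"
      unfolding \<xi>_def using u(2) by (auto simp: tendsto_fun_iff intro!: tendsto_intros)
    then have w: "limitin weak_topology (\<lambda>k. \<xi> (u k)) (\<xi> l) sequentially"
      by (rule tendsto_imp_limitin_weak_topology)
    have r: "range (\<lambda>k. \<xi> (u k)) \<subseteq> K" using u(1) \<xi>K by blast
    have "(\<lambda>k. A (\<xi> (u k))) \<longlonglongrightarrow> A (\<xi> l)"
      using A w r \<xi>K[OF l] unfolding weak_to_norm_seq_continuous_on_def by blast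
    moreover have "limitin weak_topology (\<lambda>k. a (\<xi> (u k))) (a (\<xi> l)) sequentially"
      using a w r \<xi>K[OF l] unfolding weak_to_weak_seq_continuous_on_def by blast
    ultimately show "(h i \<circ> u) \<longlonglongrightarrow> h i l"
      unfolding h_def comp_def by (intro tendsto_blinfun_apply_weak tendsto_diff tendsto_const)
  qed
  then obtain l where l: "l \<in> D" "(\<forall>i<n. h i l \<le> 0) \<or> (\<forall>i<n. 0 < l i \<longrightarrow> 0 < h i l)"
    using simplex_complementarity[OF n, of h] unfolding D_def by blast
  have "\<not> (\<forall>i<n. 0 < l i \<longrightarrow> 0 < h i l)"
  proof
    assume pos: "\<forall>i<n. 0 < l i \<longrightarrow> 0 < h i l"
    \<comment> \<open>Only the support of \<open>l\<close> is used, because the strict inequalities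
      are known only there.\<close>
    define I where "I = {i. i < n \<and> 0 < l i}"
    have I: "finite I" "I \<subseteq> {..<n}" "\<forall>i\<in>{..<n} - I. l i = 0"
      using l(1) by (auto simp: I_def D_def less_le)
    have "\<xi> l = (\<Sum>i\<in>I. l i *\<^sub>R y i)"
      unfolding \<xi>_def using I by (intro sum.mono_neutral_right) auto
    moreover have "sum l I = 1"
      using sum.mono_neutral_right[OF _ I(2,3)] l(1) by (simp add: D_def)
    ultimately have "\<xi> l \<in> convex hull (y ` I)"
      using I(1) by (auto simp: I_def hull_inc intro!: convex_sum)
    then have "A (\<xi> l) \<in> convex hull (A ` y ` I)"
      using I yK by (intro type_ql_on_convex_hull[OF ql K]) auto
    \<comment> \<open>An open half-space is convex, so it contains the hull of the images; but
      \<open>A (\<xi> l)\<close> lies on its boundary.\<close>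
    also have "\<dots> \<subseteq> {\<phi>. blinfun_apply \<phi> (a (\<xi> l)) < A (\<xi> l) (a (\<xi> l))}"
    proof (rule hull_minimal)
      show "A ` y ` I \<subseteq> {\<phi>. blinfun_apply \<phi> (a (\<xi> l)) < A (\<xi> l) (a (\<xi> l))}"
        using pos by (auto simp: I_def h_def minus_blinfun.rep_eq)
      have "linear (\<lambda>\<phi> :: 'a \<Rightarrow>\<^sub>L real. \<phi> (a (\<xi> l)))"
        by (auto intro!: linearI simp: plus_blinfun.rep_eq scaleR_blinfun.rep_eq)
      then show "convex {\<phi>. blinfun_apply \<phi> (a (\<xi> l)) < A (\<xi> l) (a (\<xi> l))}"
        using convex_linear_vimage[of _ "{..< A (\<xi> l) (a (\<xi> l))}"] by (simp add: vimage_def)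
    qed
    finally show False by simp
  qed
  with l(2) have "\<forall>i<n. h i l \<le> 0" by blast
  then show ?thesis
    using that[OF \<xi>K[OF l(1)]] by (auto simp: y h_def minus_blinfun.rep_eq)
qed

theorem theorem3p1:
  fixes K :: "'a::banach set"
    and A :: "'a \<Rightarrow> ('a \<Rightarrow>\<^sub>L real)"
    and a :: "'a \<Rightarrow> 'a"
  assumes "K \<noteq> {}"
    and "compactin weak_topology K"
    and "convex K"
    and "weak_to_norm_seq_continuous_on K A"
    and "type_ql_on K A"
    and "weak_to_weak_seq_continuous_on K a"
  shows "\<exists>x. VI_iS_solution A a K x"
proof -
  \<comment> \<open>Preimages in \<open>K\<close> have a weakly convergent subsequence, which
    \<open>A\<close> maps to a norm convergent one.\<close>
  have "seq_compact (A ` K)"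
    unfolding seq_compact_def
  proof (intro allI impI)
    fix f assume "\<forall>n :: nat. f n \<in> A ` K"
    then have "\<forall>n. \<exists>y. y \<in> K \<and> f n = A y" by blast
    then obtain u where u: "\<And>n. u n \<in> K" "\<And>n. f n = A (u n)" by metis
    then have "range u \<subseteq> K" by blast
    then obtain x r where r: "x \<in> K" "strict_mono r" "limitin weak_topology (u \<circ> r) x sequentially"
      using weakly_compact_imp_seq_compact[OF assms(2)] by metis
    have "range (u \<circ> r) \<subseteq> K" using u(1) by auto
    then have "(\<lambda>n. A ((u \<circ> r) n)) \<longlonglongrightarrow> A x"
      using assms(4) r unfolding weak_to_norm_seq_continuous_on_def by blast
    then have "(f \<circ> r) \<longlonglongrightarrow> A x" using u(2) by (simp add: comp_def)
    then show "\<exists>l\<in>A ` K. \<exists>r. strict_mono r \<and> (f \<circ> r) \<longlonglongrightarrow> l"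
      using r by blast
  qed
  note tb = seq_compact_imp_totally_bounded[OF this]
  \<comment> \<open>Finite nets of the image, pulled back to finite subsets of \<open>K\<close> to
    which \<open>VI_finite\<close> applies.\<close>
  have "\<exists>F. finite F \<and> F \<subseteq> K \<and> A ` K \<subseteq> (\<Union>y\<in>F. ball (A y) (inverse (real (Suc n))))" for n
  proof -
    obtain T where "finite T" "T \<subseteq> A ` K" "A ` K \<subseteq> (\<Union>\<phi>\<in>T. ball \<phi> (inverse (real (Suc n))))"
      using tb by (metis inverse_positive_iff_positive of_nat_0_less_iff zero_less_Suc)
    moreover obtain F where "finite F" "F \<subseteq> K" "T = A ` F"
      using finite_subset_image calculation(1,2) by metis
    ultimately show ?thesis by (intro exI[of _ F]) auto
  qed
  then obtain F where F: "\<And>n. finite (F n)" "\<And>n. F n \<subseteq> K"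
    "\<And>n. A ` K \<subseteq> (\<Union>y\<in>F n. ball (A y) (inverse (real (Suc n))))"
    by metis
  have "F n \<noteq> {}" for n using F(3)[of n] assms(1) by auto
  then have "\<exists>x. x \<in> K \<and> (\<forall>y\<in>F n. 0 \<le> (A y - A x) (a x))" for n
    using VI_finite[OF assms(3-6) F(1) _ F(2)] by metis
  then obtain u where u: "\<And>n. u n \<in> K" "\<And>n y. y \<in> F n \<Longrightarrow> 0 \<le> (A y - A (u n)) (a (u n))"
    by metis
  then have "range u \<subseteq> K" by blast
  then obtain x r where r: "x \<in> K" "strict_mono r" "limitin weak_topology (u \<circ> r) x sequentially"
    using weakly_compact_imp_seq_compact[OF assms(2)] by metis
  have ur: "range (u \<circ> r) \<subseteq> K" using u(1) by auto
  have Au: "(\<lambda>n. A ((u \<circ> r) n)) \<longlonglongrightarrow> A x"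
    using assms(4) r ur unfolding weak_to_norm_seq_continuous_on_def by blast
  have au: "limitin weak_topology (\<lambda>n. a ((u \<circ> r) n)) (a x) sequentially"
    using assms(6) r ur unfolding weak_to_weak_seq_continuous_on_def by blast
  have "0 \<le> (A y - A x) (a x)" if y: "y \<in> K" for y
  proof -
    \<comment> \<open>The fixed \<open>y\<close> need not belong to any net; net points whose images
      approach \<open>A y\<close> carry the inequality at \<open>u n\<close> to the limit.\<close>
    have "\<exists>z\<in>F n. dist (A z) (A y) < inverse (real (Suc n))" for n
    proof -
      have "A y \<in> (\<Union>z\<in>F n. ball (A z) (inverse (real (Suc n))))" using F(3) y by blast
      then show ?thesis by (simp only: UN_iff mem_ball)
    qed
    then obtain z where z: "\<And>n. z n \<in> F n" "\<And>n. dist (A (z n)) (A y) < inverse (real (Suc n))"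
      by metis
    have "(\<lambda>n. A (z n)) \<longlonglongrightarrow> A y"
    proof (rule metric_tendsto_imp_tendsto[OF LIMSEQ_inverse_real_of_nat])
      show "eventually (\<lambda>n. dist (A (z n)) (A y) \<le> dist (inverse (real (Suc n))) 0) sequentially"
        using z(2) by (intro always_eventually allI) (simp add: less_imp_le)
    qed
    from LIMSEQ_subseq_LIMSEQ[OF this r(2)] have "(\<lambda>n. A (z (r n))) \<longlonglongrightarrow> A y" by (simp add: comp_def)
    from tendsto_blinfun_apply_weak[OF tendsto_diff[OF this Au] au]
    show ?thesis
      by (rule LIMSEQ_le_const) (use u(2) z(1) in auto)
  qed
  then show ?thesis using r(1) unfolding VI_iS_solution_def by blast
qed

end
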